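(* Let $n \ge 1$, let $\mathbf{A}$ be a nonsingular complex $n\times n$ matrix, and let $\mathbf{\Theta} = \mathbf{v}\mathbf{u}^T$ be an $n\times n$ rank-one angle matrix, where $\mathbf{v} = (e^{j\theta_i})\in\mathbb{C}^n$ and $\mathbf{u} = (e^{j\phi_i})\in\mathbb{C}^n$ with $\theta_i,\phi_i\in\mathbb{R}$ for all $i$. Then the inverse of $\mathbf{A}\circ\mathbf{\Theta}$ can be expressed as $$(\mathbf{A}\circ\mathbf{\Theta})^{-1} = \mathbf{A}^{-1}\circ\mathbf{\Theta}^H .$$
   Context: Here $j$ in exponents denotes the imaginary unit. For two matrices $\mathbf{A}=(a_{ij})$, $\mathbf{B}=(b_{ij})$ of the same size, the Hadamard product is the entrywise product $\mathbf{A}\circ\mathbf{B}=(a_{ij}b_{ij})$. $\mathbf{A}^T$ denotes the transpose and $\mathbf{A}^H$ the conjugate transpose. An angle vector is a column vector of the form $(e^{j\theta_i})$ with all $\theta_i$ real; given angle vectors $\mathbf{v}=(e^{j\theta_i})\in\mathbb{C}^m$ and $\mathbf{u}=(e^{j\phi_i})\in\mathbb{C}^n$, the $m\times n$ rank-one angle matrix they define is $\mathbf{\Theta}=\mathbf{v}\mathbf{u}^T$, whose $(i,k)$ entry is $e^{j(\theta_i+\phi_k)}$. *)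

theory Defs
  imports "HOL-Analysis.Analysis"
begin

(* Multiplication on the type vec is componentwise, so on matrices it is already the
   Hadamard product; the matrix product is ( ** ). *)
abbreviation hadamard :: "complex^'n^'m \<Rightarrow> complex^'n^'m \<Rightarrow> complex^'n^'m"
  (infixl \<open>\<circ>\<^sub>H\<close> 70)
  where "A \<circ>\<^sub>H B \<equiv> A * B"

lemma hadamard_nth: "(A \<circ>\<^sub>H B) $ i $ k = A $ i $ k * B $ i $ k"
  by simp

definition conj_transpose :: "complex^'n^'m \<Rightarrow> complex^'m^'n"
  where "conj_transpose A = (\<chi> i k. cnj (A $ k $ i))"

definition angle_vector :: "real^'n \<Rightarrow> complex^'n"
  where "angle_vector \<theta> = (\<chi> i. exp (\<i> * complex_of_real (\<theta> $ i)))"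

(* The index type 1 makes the factors an m x 1 and a 1 x n matrix. *)
definition rank_one_angle_matrix :: "real^'m \<Rightarrow> real^'n \<Rightarrow> complex^'n^'m"
  where "rank_one_angle_matrix \<theta> \<phi> =
    (columnvector (angle_vector \<theta>) :: complex^1^'m) **
    transpose (columnvector (angle_vector \<phi>) :: complex^1^'n)"

lemma rank_one_angle_matrix_nth:
  "rank_one_angle_matrix \<theta> \<phi> $ i $ k = exp (\<i> * complex_of_real (\<theta> $ i + \<phi> $ k))"
  by (simp add: rank_one_angle_matrix_def angle_vector_def columnvector_def transpose_def
      matrix_matrix_mult_def exp_add distrib_left)

end

theory Submission
  imports Defs
begin

text \<open>In an entry of the product of \<open>A \<circ>\<^sub>H \<Theta>\<close> and \<open>A\<inverse> \<circ>\<^sub>H \<Theta>\<^sup>H\<close> the phase depending on the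
  summation index cancels. What remains is the entry of the identity matrix times a phase
  that equals \<open>1\<close> on the diagonal.\<close>

lemma matrix_inv_right:
  fixes A :: "'a::semiring_1^'n^'m"
  assumes "invertible A"
  shows "A ** matrix_inv A = mat 1"
  using someI_ex[OF assms[unfolded invertible_def]] by (simp add: matrix_inv_def)

text \<open>\<open>matrix_inv\<close> is a Hilbert choice among the two-sided inverses, so
  identifying it with \<open>B\<close> takes the usual uniqueness argument: evaluate
  \<open>B ** A ** matrix_inv A\<close> in two ways.\<close>

lemma matrix_inv_unique:
  fixes A :: "'a::semiring_1^'n^'m"
  assumes "A ** B = mat 1" and "B ** A = mat 1"
  shows "matrix_inv A = B"
proof -
  have "A ** matrix_inv A = mat 1"
    using assms by (intro matrix_inv_right) (auto simp: invertible_def)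
  then have "B ** A ** matrix_inv A = B"
    by (simp flip: matrix_mul_assoc)
  then show ?thesis
    by (simp add: assms(2))
qed

text \<open>Conjugation turns the shared column phase \<phi> into its reciprocal, so each summand
  carries the same phase, which leaves the sum.\<close>

lemma hadamard_angle_matrix_mult:
  fixes A :: "complex^'n^'m" and B :: "complex^'k^'n"
  shows "((A \<circ>\<^sub>H rank_one_angle_matrix \<theta> \<phi>) **
      (B \<circ>\<^sub>H conj_transpose (rank_one_angle_matrix \<psi> \<phi>))) $ i $ k =
    exp (\<i> * complex_of_real (\<theta> $ i - \<psi> $ k)) * (A ** B) $ i $ k"
proof -
  have phase: "exp (\<i> * complex_of_real (\<theta> $ i + \<phi> $ l)) *
      cnj (exp (\<i> * complex_of_real (\<psi> $ k + \<phi> $ l))) =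
      exp (\<i> * complex_of_real (\<theta> $ i - \<psi> $ k))" for l
    by (simp add: exp_cnj algebra_simps flip: exp_add)
  have "(A $ i $ l * exp (\<i> * complex_of_real (\<theta> $ i + \<phi> $ l))) *
      (B $ l $ k * cnj (exp (\<i> * complex_of_real (\<psi> $ k + \<phi> $ l)))) =
      exp (\<i> * complex_of_real (\<theta> $ i - \<psi> $ k)) * (A $ i $ l * B $ l $ k)" for l
    \<comment> \<open>Splitting the phase on the right into its two factors makes both sides equal
      up to reordering.\<close>
    unfolding phase[of l, symmetric] by (simp only: mult_ac)
  then show ?thesis
    by (simp only: matrix_matrix_mult_def conj_transpose_def vec_lambda_beta
        hadamard_nth rank_one_angle_matrix_nth sum_distrib_left)
qed

lemma hadamard_angle_matrix_right_inverse:
  fixes A :: "complex^'n^'m" and B :: "complex^'m^'n"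
  assumes "A ** B = mat 1"
  shows "(A \<circ>\<^sub>H rank_one_angle_matrix \<theta> \<phi>) **
    (B \<circ>\<^sub>H conj_transpose (rank_one_angle_matrix \<theta> \<phi>)) = mat 1"
  by (simp add: vec_eq_iff hadamard_angle_matrix_mult assms mat_def)

theorem theorem3:
  fixes A \<Theta> :: "complex^'n^'n" and \<theta> \<phi> :: "real^'n"
  assumes "invertible A"
    and "\<Theta> = rank_one_angle_matrix \<theta> \<phi>"
  shows "invertible (A \<circ>\<^sub>H \<Theta>) \<and>
    matrix_inv (A \<circ>\<^sub>H \<Theta>) = matrix_inv A \<circ>\<^sub>H conj_transpose \<Theta>"
proof -
  have right: "(A \<circ>\<^sub>H \<Theta>) ** (matrix_inv A \<circ>\<^sub>H conj_transpose \<Theta>) = mat 1"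
    unfolding assms(2)
    by (intro hadamard_angle_matrix_right_inverse matrix_inv_right assms(1))
  \<comment> \<open>A right inverse of a square matrix over a field is also a left inverse, which
    spares a second phase computation.\<close>
  then have left: "(matrix_inv A \<circ>\<^sub>H conj_transpose \<Theta>) ** (A \<circ>\<^sub>H \<Theta>) = mat 1"
    by (simp only: matrix_left_right_inverse)
  from right left show ?thesis
    by (auto simp: invertible_def intro: matrix_inv_unique)
qed

end
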